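(* Let $f:(a,b)\to\mathbb{R}$ be a $\Phi$-convex function with $\Phi>0$ on $[0,b-a]$, and let $\varphi:(a,b)\to\mathbb{R}$ be a function such that $f(u)+(x-u)\varphi(u)\le f(x)+\Phi(|u-x|)$ for all $x,u\in(a,b)$. Let $x_1,\dots,x_n\in(a,b)$, let $(a_1,\dots,a_n)$ be a nonnegative $n$-tuple with $A_n=\sum_{i=1}^n a_i>0$, let $\overline{x}=\frac{1}{A_n}\sum_{i=1}^n a_ix_i$, and let $\lambda_i\in[0,1]$, $i=1,\dots,n$. Then $$\frac{1}{A_n}\sum_{i=1}^n a_if(x_i)-\frac{1}{A_n}\sum_{i=1}^n a_if\big((1-\lambda_i)\overline{x}+\lambda_ix_i\big)$$ $$\le\frac{1}{A_n}\sum_{i=1}^n a_i(1-\lambda_i)\varphi(x_i)(x_i-\overline{x})+\frac{1}{A_n}\sum_{i=1}^n a_i\Phi\big((1-\lambda_i)|\overline{x}-x_i|\big).$$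
   Context: A real function $f$ on an interval with endpoints $a<b$ is $\Phi$-convex, with error function $\Phi:[0,b-a]\to[0,\infty)$, if $tf(x)+(1-t)f(y)+t\Phi((1-t)|x-y|)+(1-t)\Phi(t|x-y|)\ge f(tx+(1-t)y)$ for all $x,y$ in the interval and all $t\in[0,1]$. It is known that for such $f$ a function $\varphi$ with $f(u)+(x-u)\varphi(u)\le f(x)+\Phi(|u-x|)$ for all $x,u$ exists. *)

theory Defs
  imports Complex_Main
begin

text \<open>
  The interval \<open>I\<close> may contain none, one or both of its endpoints \<open>a < b\<close>.  The error
  function is total in HOL, but only its values on \<open>{0..b - a}\<close> are constrained or used.
\<close>

definition Phi_convex_on ::
  "real \<Rightarrow> real \<Rightarrow> real set \<Rightarrow> (real \<Rightarrow> real) \<Rightarrow> (real \<Rightarrow> real) \<Rightarrow> bool" where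
  "Phi_convex_on a b I \<Phi> f \<longleftrightarrow>
     a < b \<and> {a<..<b} \<subseteq> I \<and> I \<subseteq> {a..b} \<and>
     (\<forall>s\<in>{0..b - a}. 0 \<le> \<Phi> s) \<and>
     (\<forall>x\<in>I. \<forall>y\<in>I. \<forall>t\<in>{0..1}.
        f (t * x + (1 - t) * y)
          \<le> t * f x + (1 - t) * f y
             + t * \<Phi> ((1 - t) * \<bar>x - y\<bar>) + (1 - t) * \<Phi> (t * \<bar>x - y\<bar>))"

end

theory Submission
  imports Defs "HOL-Analysis.Convex"
begin

text \<open>The defining inequality of \<open>\<phi>\<close> is a support-line estimate with error
  \<open>\<Phi>\<close>. Taking the base point at \<open>x i\<close> and the test point
  \<open>?y i\<close> on the segment from \<open>xbar\<close> to \<open>x i\<close> gives a bound on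
  \<open>f (x i) - f (?y i)\<close>, and since \<open>?y i - x i = (1 - l i) * (xbar - x i)\<close>,
  both the linear term and the argument of \<open>\<Phi>\<close> take the form in the claim. The
  nonnegative weights \<open>w i\<close> preserve these bounds, so summing them and dividing by
  \<open>A > 0\<close> finishes. Convexity of the open interval (\<open>convex_sum\<close>,
  \<open>convexD\<close>) keeps \<open>xbar\<close> and each \<open>?y i\<close> where the estimate
  is available.\<close>

theorem theorem14:
  fixes a b :: real
    and f \<phi> \<Phi> :: "real \<Rightarrow> real"
    and n :: nat
    and x w l :: "nat \<Rightarrow> real"
    and A xbar :: real
  assumes "Phi_convex_on a b {a<..<b} \<Phi> f"
    and "\<forall>s\<in>{0..b - a}. 0 < \<Phi> s"
    and "\<forall>y\<in>{a<..<b}. \<forall>u\<in>{a<..<b}. f u + (y - u) * \<phi> u \<le> f y + \<Phi> \<bar>u - y\<bar>"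
    and "\<forall>i\<in>{1..n}. x i \<in> {a<..<b}"
    and "\<forall>i\<in>{1..n}. 0 \<le> w i"
    and "A = (\<Sum>i=1..n. w i)"
    and "0 < A"
    and "xbar = 1 / A * (\<Sum>i=1..n. w i * x i)"
    and "\<forall>i\<in>{1..n}. l i \<in> {0..1}"
  shows "1 / A * (\<Sum>i=1..n. w i * f (x i))
           - 1 / A * (\<Sum>i=1..n. w i * f ((1 - l i) * xbar + l i * x i))
         \<le> 1 / A * (\<Sum>i=1..n. w i * (1 - l i) * \<phi> (x i) * (x i - xbar))
           + 1 / A * (\<Sum>i=1..n. w i * \<Phi> ((1 - l i) * \<bar>xbar - x i\<bar>))"
proof -
  let ?y = "\<lambda>i. (1 - l i) * xbar + l i * x i"
  \<comment> \<open>The normalised weights \<open>w i / A\<close> sum to 1, so \<open>xbar\<close>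
    is a convex combination of the points \<open>x i\<close>.\<close>
  have "(\<Sum>i=1..n. (w i / A) *\<^sub>R x i) \<in> {a<..<b}"
  proof (rule convex_sum)
    show "(\<Sum>i=1..n. w i / A) = 1"
      using assms(6,7) by (simp flip: sum_divide_distrib)
  qed (use assms(4,5,7) convex_real_interval in auto)
  then have xbar: "xbar \<in> {a<..<b}"
    using assms(8) by (simp add: sum_distrib_left)
  have bound: "w i * f (x i) \<le> w i * f (?y i) + w i * (1 - l i) * \<phi> (x i) * (x i - xbar)
      + w i * \<Phi> ((1 - l i) * \<bar>xbar - x i\<bar>)" if i: "i \<in> {1..n}" for i
  proof -
    have l: "0 \<le> l i" "l i \<le> 1" and xi: "x i \<in> {a<..<b}" and w: "0 \<le> w i"
      using assms(4,5,9) i by auto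
    have y: "?y i \<in> {a<..<b}"
      using convexD[OF convex_real_interval(8) xbar xi, of "1 - l i" "l i"] l by simp
    have diff: "?y i - x i = (1 - l i) * (xbar - x i)"
      by (simp add: algebra_simps)
    \<comment> \<open>The factor \<open>1 - l i\<close> leaves the absolute value unchanged because
      \<open>l i \<le> 1\<close>.\<close>
    have "\<bar>x i - ?y i\<bar> = (1 - l i) * \<bar>xbar - x i\<bar>"
      using diff l by (simp add: abs_minus_commute[of "x i"] abs_mult)
    \<comment> \<open>This is the support inequality with \<open>u = x i\<close> and
      \<open>y = ?y i\<close>; moving the linear term to the right then turns
      \<open>xbar - x i\<close> into \<open>x i - xbar\<close>.\<close>
    then have "f (x i) + (1 - l i) * (xbar - x i) * \<phi> (x i)
        \<le> f (?y i) + \<Phi> ((1 - l i) * \<bar>xbar - x i\<bar>)"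
      using assms(3) y xi diff by metis
    from mult_left_mono[OF this w] show ?thesis
      by (simp add: algebra_simps)
  qed
  have "(\<Sum>i=1..n. w i * f (x i)) - (\<Sum>i=1..n. w i * f (?y i))
      \<le> (\<Sum>i=1..n. w i * (1 - l i) * \<phi> (x i) * (x i - xbar))
        + (\<Sum>i=1..n. w i * \<Phi> ((1 - l i) * \<bar>xbar - x i\<bar>))"
    using sum_mono[of "{1..n}" "\<lambda>i. w i * f (x i)", OF bound] by (simp add: sum.distrib)
  then have "1 / A * ((\<Sum>i=1..n. w i * f (x i)) - (\<Sum>i=1..n. w i * f (?y i)))
      \<le> 1 / A * ((\<Sum>i=1..n. w i * (1 - l i) * \<phi> (x i) * (x i - xbar))
        + (\<Sum>i=1..n. w i * \<Phi> ((1 - l i) * \<bar>xbar - x i\<bar>)))"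
    using assms(7) by (intro mult_left_mono) auto
  then show ?thesis
    by (simp only: distrib_left right_diff_distrib)
qed

end
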